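(* Let $n$ be a positive integer, let $\alpha \in (0,1)$, and let $\mathcal{A}$ be a random set in $\mathcal{B}(n,\alpha)$. Define $\beta_0 := 1$, $\beta_1 := 1$, and $\beta_{i+1} := (1-\alpha)\beta_i + \alpha(1-\alpha)\beta_{i-1}$ for all integers $i \geq 1$, and put $\gamma_i := \beta_{i-1}\beta_{i+1}/\beta_i^2$ for all integers $i \geq 1$. Then, for all positive integers $r < s$ with $\gcd(r,s) = 1$, we have $$\mathbb{P}\big(r/s \in \mathcal{A}/\mathcal{A}\big) = 1 - \prod_{i=1}^{\left\lfloor \frac{\log n}{\log s}\right\rfloor} \gamma_i^{\lfloor n/s^i \rfloor}.$$
   Context: For a positive integer $n$ and $\alpha \in (0,1)$, $\mathcal{B}(n,\alpha)$ denotes the probabilistic model in which a random set $\mathcal{A} \subseteq \{1,\dots,n\}$ is constructed by picking independently every element of $\{1,\dots,n\}$ with probability $\alpha$. The ratio set of $\mathcal{A}$ is $\mathcal{A}/\mathcal{A} := \{a/b : a,b \in \mathcal{A}\}$. An empty product equals $1$. *)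

theory Defs
  imports "HOL-Probability.Probability"
begin

text \<open>The model \<open>\<B>(n, \<alpha>)\<close>: independent coins \<open>b x\<close> (\<open>1 \<le> x \<le> n\<close>), each true with probability
  \<open>\<alpha>\<close>, and the set of those \<open>x\<close> whose coin came up true. The parameter \<open>False\<close> is only the value
  of the coin function outside \<open>{1..n}\<close>. Since \<^const>\<open>bernoulli_pmf\<close> clips its
  argument to the unit interval, the definition is meaningful only for \<open>0 \<le> \<alpha> \<le> 1\<close>.\<close>

definition random_subset_pmf :: "nat \<Rightarrow> real \<Rightarrow> nat set pmf" where
  "random_subset_pmf n \<alpha> =
     map_pmf (\<lambda>b. {x \<in> {1..n}. b x}) (Pi_pmf {1..n} False (\<lambda>_. bernoulli_pmf \<alpha>))"

definition ratio_set :: "nat set \<Rightarrow> rat set" where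
  "ratio_set A = {of_nat a / of_nat b | a b. a \<in> A \<and> b \<in> A}"

fun beta_seq :: "real \<Rightarrow> nat \<Rightarrow> real" where
  "beta_seq \<alpha> 0 = 1"
| "beta_seq \<alpha> (Suc 0) = 1"
| "beta_seq \<alpha> (Suc (Suc i)) = (1 - \<alpha>) * beta_seq \<alpha> (Suc i) + \<alpha> * (1 - \<alpha>) * beta_seq \<alpha> i"

text \<open>Only meaningful for \<open>i \<ge> 1\<close>, because of the truncated subtraction.\<close>

definition gamma_seq :: "real \<Rightarrow> nat \<Rightarrow> real" where
  "gamma_seq \<alpha> i = beta_seq \<alpha> (i - 1) * beta_seq \<alpha> (i + 1) / (beta_seq \<alpha> i)\<^sup>2"

end

theory Submission
  imports Defs
begin

text \<open>Join \<open>a\<close> and \<open>b\<close> by an edge if their ratio is \<open>r/s\<close> or \<open>s/r\<close>; then \<open>r/s\<close> is not a ratio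
  of elements of \<open>A\<close> iff \<open>A\<close> is an independent set. Let \<open>v\<close> be the exponent of the largest power
  of \<open>s\<close> that divides \<open>n\<close>. In \<open>{1..n}\<close> the component of \<open>n\<close> is the path
  \<open>n, n(r/s), \<dots>, n(r/s)^v\<close>. The probability of independence on a path with \<open>i\<close> vertices is \<open>\<beta>\<^sub>i\<close>,
  so passing from \<open>{1..n-1}\<close> to \<open>{1..n}\<close> multiplies the probability of independence by
  \<open>\<beta>\<^bsub>v+1\<^esub>/\<beta>\<^sub>v = \<gamma>\<^sub>1 \<cdots> \<gamma>\<^sub>v\<close>. The exponent of \<open>\<gamma>\<^sub>i\<close> thus counts the multiples
  of \<open>s^i\<close> up to \<open>n\<close>.\<close>

section \<open>Random subsets, revealed one coin at a time\<close>

text \<open>The model on an arbitrary vertex set, since the recursion along a path deletes vertices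
  from the middle of \<open>{1..n}\<close>.\<close>

definition random_subset_of :: "real \<Rightarrow> 'a set \<Rightarrow> 'a set pmf" where
  "random_subset_of \<alpha> V =
     map_pmf (\<lambda>b. {x \<in> V. b x}) (Pi_pmf V False (\<lambda>_. bernoulli_pmf \<alpha>))"

definition independent_sets :: "('a \<Rightarrow> 'a \<Rightarrow> bool) \<Rightarrow> 'a set set" where
  "independent_sets E = {A. \<forall>a\<in>A. \<forall>b\<in>A. \<not> E a b}"

definition indep_prob :: "real \<Rightarrow> ('a \<Rightarrow> 'a \<Rightarrow> bool) \<Rightarrow> 'a set \<Rightarrow> real" where
  "indep_prob \<alpha> E V = measure_pmf.prob (random_subset_of \<alpha> V) (independent_sets E)"

lemma random_subset_of_empty: "random_subset_of \<alpha> {} = return_pmf {}"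
  by (simp add: random_subset_of_def)

lemma subset_of_set_random_subset_of: "A \<in> set_pmf (random_subset_of \<alpha> V) \<Longrightarrow> A \<subseteq> V"
  by (auto simp: random_subset_of_def)

lemma prob_random_subset_of_cong:
  assumes "\<And>A. A \<subseteq> V \<Longrightarrow> A \<in> S \<longleftrightarrow> A \<in> T"
  shows "measure_pmf.prob (random_subset_of \<alpha> V) S = measure_pmf.prob (random_subset_of \<alpha> V) T"
  by (intro measure_pmf.finite_measure_eq_AE)
    (simp_all add: AE_measure_pmf_iff assms subset_of_set_random_subset_of)

lemma random_subset_of_insert:
  assumes "finite V" "x \<notin> V"
  shows "random_subset_of \<alpha> (insert x V) =
    bernoulli_pmf \<alpha> \<bind> (\<lambda>c. map_pmf (\<lambda>A. if c then insert x A else A) (random_subset_of \<alpha> V))"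
proof -
  have "{z \<in> insert x V. (f(x := c)) z} = (if c then insert x {z \<in> V. f z} else {z \<in> V. f z})"
    for f :: "'a \<Rightarrow> bool" and c
    using assms by auto
  then show ?thesis
    using assms
    by (simp add: random_subset_of_def Pi_pmf_insert' map_bind_pmf map_pmf_comp
        flip: map_pmf_def)
qed

text \<open>Condition on the coin of \<open>x\<close>.\<close>

lemma prob_random_subset_of_insert:
  assumes "finite V" "x \<notin> V" "0 \<le> \<alpha>" "\<alpha> \<le> 1"
  shows "measure_pmf.prob (random_subset_of \<alpha> (insert x V)) S =
    \<alpha> * measure_pmf.prob (random_subset_of \<alpha> V) {A. insert x A \<in> S}
    + (1 - \<alpha>) * measure_pmf.prob (random_subset_of \<alpha> V) S"
proof -
  \<comment> \<open>In \<open>ennreal\<close> the measure of the bind is a nonnegative integral over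
    the coin.\<close>
  have "ennreal (measure_pmf.prob (random_subset_of \<alpha> (insert x V)) S) =
    ennreal (\<alpha> * measure_pmf.prob (random_subset_of \<alpha> V) {A. insert x A \<in> S}
    + (1 - \<alpha>) * measure_pmf.prob (random_subset_of \<alpha> V) S)"
    using assms
    by (simp add: random_subset_of_insert vimage_def ennreal_mult' mult.commute
        flip: measure_pmf.emeasure_eq_measure)
  then show ?thesis
    using assms by (subst (asm) ennreal_inj) auto
qed

section \<open>Independence along a path\<close>

text \<open>Both outcomes of the coin of \<open>x\<close> leave the same condition on the
  rest.\<close>

lemma indep_prob_isolated:
  assumes "finite V" "x \<notin> V" "0 \<le> \<alpha>" "\<alpha> \<le> 1" "symp E"
    and "\<And>z. z \<in> insert x V \<Longrightarrow> \<not> E x z"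
  shows "indep_prob \<alpha> E (insert x V) = indep_prob \<alpha> E V"
proof -
  have "measure_pmf.prob (random_subset_of \<alpha> V) {A. insert x A \<in> independent_sets E} =
    indep_prob \<alpha> E V"
    unfolding indep_prob_def using assms(5,6)
    by (intro prob_random_subset_of_cong) (auto simp: independent_sets_def dest: sympD)
  then show ?thesis
    using assms(1-4)
    by (simp add: indep_prob_def prob_random_subset_of_insert algebra_simps)
qed

text \<open>If \<open>x\<close> is not chosen, \<open>insert y V\<close> remains; if it is chosen,
  \<open>y\<close> must be absent and \<open>V\<close> remains. This is the recurrence of
  \<open>beta_seq\<close>.\<close>

lemma indep_prob_leaf:
  assumes "finite V" "x \<notin> insert y V" "y \<notin> V" "0 \<le> \<alpha>" "\<alpha> \<le> 1" "symp E"
    and "\<And>z. z \<in> insert x (insert y V) \<Longrightarrow> E x z \<longleftrightarrow> z = y"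
  shows "indep_prob \<alpha> E (insert x (insert y V)) =
    (1 - \<alpha>) * indep_prob \<alpha> E (insert y V) + \<alpha> * (1 - \<alpha>) * indep_prob \<alpha> E V"
proof -
  have nbr: "\<not> E x x" "E x y" "\<And>z. z \<in> V \<Longrightarrow> \<not> E x z"
    using assms(2,3,7) by auto
  have "measure_pmf.prob (random_subset_of \<alpha> V) {A. insert x A \<in> independent_sets E} =
    indep_prob \<alpha> E V"
    unfolding indep_prob_def using nbr assms(6)
    by (intro prob_random_subset_of_cong) (auto simp: independent_sets_def dest: sympD)
  moreover have "{A. insert x (insert y A) \<in> independent_sets E} = {}"
    using nbr by (auto simp: independent_sets_def)
  ultimately show ?thesis
    using assms(1-5)
    by (simp add: indep_prob_def prob_random_subset_of_insert algebra_simps)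
qed

lemma beta_seq_pos:
  assumes "0 < \<alpha>" "\<alpha> < 1"
  shows "beta_seq \<alpha> i > 0"
  using assms by (induction \<alpha> i rule: beta_seq.induct) (auto intro!: add_pos_pos mult_pos_pos)

text \<open>The hypothesis says that \<open>x 0, \<dots>, x i\<close> induces a path that is a connected component
  of \<open>V\<close>; it is phrased so that it survives the removal of the endpoint \<open>x i\<close>. Cross-multiplying
  by \<open>\<beta>\<^sub>i\<close> makes independence of the remaining vertices unnecessary.\<close>

lemma indep_prob_path_end:
  assumes "finite V" "0 < \<alpha>" "\<alpha> < 1" "symp E" "inj_on x {..i}" "x ` {..i} \<subseteq> V"
    and "\<And>j y. j \<le> i \<Longrightarrow> y \<in> V - x ` {j<..i} \<Longrightarrow> E (x j) y \<longleftrightarrow> j > 0 \<and> y = x (j - 1)"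
  shows "indep_prob \<alpha> E V * beta_seq \<alpha> i = indep_prob \<alpha> E (V - {x i}) * beta_seq \<alpha> (Suc i)"
  using assms
proof (induction i arbitrary: V)
  case 0
  \<comment> \<open>The only path vertex is isolated, and \<beta>_0 = \<beta>_1 = 1.\<close>
  then have "V = insert (x 0) (V - {x 0})"
    by auto
  moreover have "indep_prob \<alpha> E (insert (x 0) (V - {x 0})) = indep_prob \<alpha> E (V - {x 0})"
    using 0 by (intro indep_prob_isolated) auto
  ultimately show ?case
    by simp
next
  case (Suc i)
  let ?V = "V - {x (Suc i)}" and ?W = "V - {x (Suc i)} - {x i}"
  have ne: "x (Suc i) \<noteq> x j" if "j \<le> i" for j
    using inj_onD[OF Suc.prems(5), of "Suc i" j] that by auto
  have V: "insert (x i) ?W = ?V" "insert (x (Suc i)) ?V = V"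
    using Suc.prems(6) ne[of i] by auto
  have E_end: "E (x (Suc i)) z \<longleftrightarrow> z = x i" if "z \<in> V" for z
    using Suc.prems(7)[of "Suc i" z] that by simp
  have rec: "indep_prob \<alpha> E V =
    (1 - \<alpha>) * indep_prob \<alpha> E ?V + \<alpha> * (1 - \<alpha>) * indep_prob \<alpha> E ?W"
    by (rule indep_prob_leaf[of ?W "x (Suc i)" "x i" \<alpha> E, unfolded V])
      (use Suc.prems(1-4) E_end in auto)
  have "indep_prob \<alpha> E ?V * beta_seq \<alpha> i = indep_prob \<alpha> E ?W * beta_seq \<alpha> (Suc i)"
  proof (rule Suc.IH)
    show "inj_on x {..i}"
      using Suc.prems(5) by (rule inj_on_subset) auto
    show "x ` {..i} \<subseteq> ?V"
      using Suc.prems(6) ne by fastforce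
    fix j y
    assume "j \<le> i" "y \<in> ?V - x ` {j<..i}"
    moreover from this have "y \<in> V - x ` {j<..Suc i}"
      by (auto simp: le_Suc_eq)
    ultimately show "E (x j) y \<longleftrightarrow> j > 0 \<and> y = x (j - 1)"
      by (intro Suc.prems(7)) auto
  qed (use Suc.prems in auto)
  \<comment> \<open>Multiply \<open>rec\<close> by \<beta>_(i+1) and replace the \<open>?W\<close>
    term using the induction hypothesis: \<open>?V\<close> then has the factor (1-\<alpha>)
    \<beta>_(i+1) + \<alpha>(1-\<alpha>) \<beta>_i = \<beta>_(i+2).\<close>
  then show ?case
    by (simp add: rec algebra_simps)
qed

text \<open>The product telescopes: \<gamma>_i is the quotient of \<beta>_(i+1)/\<beta>_i by
  \<beta>_i/\<beta>_(i-1), and \<beta>_1/\<beta>_0 = 1.\<close>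

lemma prod_gamma_seq:
  assumes "0 < \<alpha>" "\<alpha> < 1"
  shows "(\<Prod>i = 1..v. gamma_seq \<alpha> i) = beta_seq \<alpha> (Suc v) / beta_seq \<alpha> v"
proof (induction v)
  case (Suc v)
  then show ?case
    using beta_seq_pos[OF assms, of v] beta_seq_pos[OF assms, of "Suc v"]
    by (simp add: gamma_seq_def power2_eq_square field_simps del: beta_seq.simps)
qed simp

section \<open>The graph of the ratio r/s\<close>

definition ratio_edge :: "nat \<Rightarrow> nat \<Rightarrow> nat \<Rightarrow> nat \<Rightarrow> bool" where
  "ratio_edge r s a b \<longleftrightarrow> a * s = b * r \<or> b * s = a * r"

lemma symp_ratio_edge: "symp (ratio_edge r s)"
  by (auto simp: symp_def ratio_edge_def)

text \<open>Independence quantifies over ordered pairs, so the two disjuncts of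
  \<open>ratio_edge\<close> amount to one. Excluding 0 keeps denominators nonzero, as division by 0
  would yield 0.\<close>

lemma ratio_set_iff_ratio_edge:
  assumes "0 \<notin> A" "0 < s"
  shows "of_nat r / of_nat s \<in> ratio_set A \<longleftrightarrow> A \<notin> independent_sets (ratio_edge r s)"
proof -
  have "(of_nat r / of_nat s :: rat) = of_nat a / of_nat b \<longleftrightarrow> a * s = b * r"
    if "a \<in> A" "b \<in> A" for a b
  proof -
    have "b \<noteq> 0"
      using assms(1) that(2) by metis
    then have "(of_nat r / of_nat s :: rat) = of_nat a / of_nat b \<longleftrightarrow>
      (of_nat (a * s) :: rat) = of_nat (b * r)"
      using assms by (auto simp: field_simps)
    then show ?thesis
      by (simp only: of_nat_eq_iff)
  qed
  then show ?thesis
    unfolding ratio_set_def independent_sets_def ratio_edge_def by blast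
qed

lemma indep_prob_ratio_edge_step:
  fixes m v r s :: nat and \<alpha> :: real
  defines "n \<equiv> m * s ^ v"
  assumes "0 < \<alpha>" "\<alpha> < 1" "0 < r" "r < s" "coprime r s" "\<not> s dvd m"
  shows "indep_prob \<alpha> (ratio_edge r s) {1..n} * beta_seq \<alpha> v =
    indep_prob \<alpha> (ratio_edge r s) {1..<n} * beta_seq \<alpha> (Suc v)"
proof -
  \<comment> \<open>Numbered upwards by the factor s/r, so that the endpoint to be removed is
    \<open>x v = n\<close>.\<close>
  define x where "x j = m * s ^ j * r ^ (v - j)" for j
  have m: "m > 0"
    using assms(7) by (cases "m = 0") auto
  have x_pos: "x j > 0" for j
    using m assms by (simp add: x_def)
  have x_Suc: "x j * s = x (Suc j) * r" if "j < v" for j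
    using that by (simp add: x_def Suc_diff_Suc[symmetric] mult_ac)
  have x_v: "x v = n"
    by (simp add: x_def n_def)
  have x_less: "x j < x (Suc j)" if "j < v" for j
  proof (rule ccontr)
    assume "\<not> x j < x (Suc j)"
    then have "x (Suc j) * r \<le> x j * r"
      by simp
    also have "\<dots> < x j * s"
      using x_pos assms by simp
    finally show False
      using x_Suc[OF that] by simp
  qed
  have mono: "x j < x k" if "j < k" "k \<le> v" for j k
    using that
  proof (induction k)
    case (Suc k)
    then show ?case
      using x_less[of k] by (cases "j = k") auto
  qed simp
  have inj: "inj_on x {..v}"
    using mono by (intro linorder_inj_onI) (auto dest: less_imp_neq)
  have le: "x j \<le> n" if "j \<le> v" for j
    using mono[of j v] that x_v by (cases "j = v") auto
  have edge: "ratio_edge r s (x j) y \<longleftrightarrow> j > 0 \<and> y = x (j - 1)"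
    if j: "j \<le> v" and y: "y \<in> {1..n} - x ` {j<..v}" for j y
  proof
    assume "ratio_edge r s (x j) y"
    then consider "x j * s = y * r" | "y * s = x j * r"
      by (auto simp: ratio_edge_def)
    then show "j > 0 \<and> y = x (j - 1)"
    proof cases
      \<comment> \<open>Here \<open>y\<close> is \<open>x j * s / r\<close>: beyond \<open>n\<close>
        if \<open>j = v\<close>, otherwise the excluded vertex \<open>x (Suc j)\<close>.\<close>
      case 1
      show ?thesis
      proof (cases "j = v")
        case True
        then have "n * s = y * r"
          using 1 x_v by simp
        also have "\<dots> \<le> n * r"
          using y by simp
        also have "\<dots> < n * s"
          using x_pos[of v] x_v assms by simp
        finally show ?thesis
          by simp
      next
        case False
        then have "y = x (Suc j)"
          using 1 x_Suc[of j] j assms by simp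
        then show ?thesis
          using y j False by auto
      qed
    next
      \<comment> \<open>Here \<open>y\<close> is \<open>x j * r / s\<close>. For
        \<open>j = 0\<close> this is no integer, because \<open>s\<close> is coprime to
        \<open>r\<close> and does not divide \<open>m\<close>.\<close>
      case 2
      show ?thesis
      proof (cases j)
        case 0
        then have "s dvd m * r ^ Suc v"
          using 2 by (metis dvd_triv_right mult.assoc mult.right_neutral power_0 power_Suc2
              x_def diff_zero)
        then show ?thesis
          using assms by (simp add: coprime_dvd_mult_left_iff coprime_commute del: power_Suc)
      next
        case (Suc k)
        then have "y * s = x k * s"
          using 2 x_Suc[of k] j by simp
        then show ?thesis
          using Suc assms by simp
      qed
    qed
  next
    assume *: "j > 0 \<and> y = x (j - 1)"
    then have "j - 1 < v"
      using j by linarith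
    then show "ratio_edge r s (x j) y"
      using x_Suc[of "j - 1"] * by (simp add: ratio_edge_def)
  qed
  have "indep_prob \<alpha> (ratio_edge r s) {1..n} * beta_seq \<alpha> v =
    indep_prob \<alpha> (ratio_edge r s) ({1..n} - {x v}) * beta_seq \<alpha> (Suc v)"
    using assms(2,3) inj edge le x_pos
    by (intro indep_prob_path_end symp_ratio_edge) (auto simp: Suc_le_eq)
  moreover have "{1..n} - {x v} = {1..<n}"
    using x_v by auto
  ultimately show ?thesis
    by simp
qed

text \<open>Induction on \<open>n\<close> with a fixed upper limit \<open>N\<close>, so that the
  range of the product does not change; the surplus factors have exponent 0.\<close>

lemma indep_prob_ratio_edge:
  assumes "0 < \<alpha>" "\<alpha> < 1" "0 < r" "r < s" "coprime r s" "n \<le> N"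
  shows "indep_prob \<alpha> (ratio_edge r s) {1..n} = (\<Prod>i = 1..N. gamma_seq \<alpha> i ^ (n div s ^ i))"
  using assms(6)
proof (induction n)
  case 0
  then show ?case
    by (simp add: indep_prob_def random_subset_of_empty independent_sets_def)
next
  case (Suc n)
  have s: "s > 1"
    using assms by simp
  define v where "v = multiplicity s (Suc n)"
  obtain m where m: "Suc n = m * s ^ v" "\<not> s dvd m"
    using multiplicity_decompose'[of "Suc n" s] s by (auto simp: v_def mult.commute)
  have dvd: "s ^ i dvd Suc n \<longleftrightarrow> i \<le> v" for i
    unfolding v_def using s by (intro power_dvd_iff_le_multiplicity) auto
  have "v < s ^ v"
    using s by (simp add: power_gt_expt)
  also have "s ^ v \<le> Suc n"
    using dvd[of v] by (intro dvd_imp_le) auto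
  finally have "v \<le> N"
    using Suc.prems by simp
  \<comment> \<open>The quotient by \<open>s ^ i\<close> grows by one exactly when
    \<open>s ^ i\<close> divides \<open>Suc n\<close>, that is, when
    \<open>i \<le> v\<close>.\<close>
  have "(\<Prod>i = 1..N. gamma_seq \<alpha> i ^ (Suc n div s ^ i)) =
    (\<Prod>i = 1..N. gamma_seq \<alpha> i ^ (n div s ^ i) * (if i \<le> v then gamma_seq \<alpha> i else 1))"
    using dvd by (intro prod.cong refl) (auto simp: div_Suc mod_eq_0_iff_dvd)
  also have "\<dots> = (\<Prod>i = 1..N. gamma_seq \<alpha> i ^ (n div s ^ i)) *
    (\<Prod>i = 1..N. if i \<le> v then gamma_seq \<alpha> i else 1)"
    by (rule prod.distrib)
  also have "(\<Prod>i = 1..N. if i \<le> v then gamma_seq \<alpha> i else 1) = (\<Prod>i = 1..v. gamma_seq \<alpha> i)"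
    using \<open>v \<le> N\<close> by (intro prod.mono_neutral_cong_right) auto
  also have "\<dots> = beta_seq \<alpha> (Suc v) / beta_seq \<alpha> v"
    using assms by (intro prod_gamma_seq)
  also have "(\<Prod>i = 1..N. gamma_seq \<alpha> i ^ (n div s ^ i)) =
    indep_prob \<alpha> (ratio_edge r s) {1..<Suc n}"
    using Suc by (simp add: atLeastLessThanSuc_atLeastAtMost)
  also have "\<dots> * (beta_seq \<alpha> (Suc v) / beta_seq \<alpha> v) = indep_prob \<alpha> (ratio_edge r s) {1..Suc n}"
    using indep_prob_ratio_edge_step[OF assms(1-5) m(2), of v] m(1) beta_seq_pos[OF assms(1,2), of v]
    by (simp add: field_simps del: beta_seq.simps)
  finally show ?case ..
qed

section \<open>The logarithmic cut-off and the final formula\<close>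

lemma less_power_of_floor_ln_div_less:
  fixes n s i :: nat
  assumes "n > 0" "s > 1" "i > nat \<lfloor>ln (real n) / ln (real s)\<rfloor>"
  shows "n < s ^ i"
proof -
  have "ln (real n) / ln (real s) < real i"
    using assms by linarith
  then have "ln (real n) < ln (real s ^ i)"
    using assms by (simp add: field_simps ln_realpow)
  then have "real n < real (s ^ i)"
    using assms by simp
  then show ?thesis
    by (simp only: of_nat_less_iff)
qed

theorem theorem1p2:
  fixes n r s :: nat and \<alpha> :: real
  assumes "n > 0" and "0 < \<alpha>" and "\<alpha> < 1"
    and "0 < r" and "r < s" and "coprime r s"
  shows "measure_pmf.prob (random_subset_pmf n \<alpha>) {A. of_nat r / of_nat s \<in> ratio_set A}
         = 1 - (\<Prod>i = 1..nat \<lfloor>ln (real n) / ln (real s)\<rfloor>. gamma_seq \<alpha> i ^ (n div s ^ i))"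
proof -
  define L where "L = nat \<lfloor>ln (real n) / ln (real s)\<rfloor>"
  have "measure_pmf.prob (random_subset_pmf n \<alpha>) {A. of_nat r / of_nat s \<in> ratio_set A} =
    measure_pmf.prob (random_subset_of \<alpha> {1..n}) {A. of_nat r / of_nat s \<in> ratio_set A}"
    by (simp add: random_subset_pmf_def random_subset_of_def)
  also have "\<dots> =
    measure_pmf.prob (random_subset_of \<alpha> {1..n}) (- independent_sets (ratio_edge r s))"
  proof (rule prob_random_subset_of_cong)
    fix A :: "nat set"
    assume "A \<subseteq> {1..n}"
    then have "0 \<notin> A"
      by auto
    then show "A \<in> {A. of_nat r / of_nat s \<in> ratio_set A} \<longleftrightarrow>
      A \<in> - independent_sets (ratio_edge r s)"
      using ratio_set_iff_ratio_edge[of A s r] assms by auto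
  qed
  also have "\<dots> = 1 - indep_prob \<alpha> (ratio_edge r s) {1..n}"
    using measure_pmf.prob_compl[of "independent_sets (ratio_edge r s)"]
    by (simp add: indep_prob_def Compl_eq_Diff_UNIV)
  \<comment> \<open>The limit \<open>n + L\<close> is at least \<open>n\<close>, as the product
    formula requires, and at least \<open>L\<close>, so that it can be cut down to \<open>L\<close>:
    for \<open>i > L\<close> the exponent is 0.\<close>
  also have "indep_prob \<alpha> (ratio_edge r s) {1..n} =
    (\<Prod>i = 1..n + L. gamma_seq \<alpha> i ^ (n div s ^ i))"
    using assms by (intro indep_prob_ratio_edge) auto
  also have "\<dots> = (\<Prod>i = 1..L. gamma_seq \<alpha> i ^ (n div s ^ i))"
    using assms less_power_of_floor_ln_div_less[of n s]
    by (intro prod.mono_neutral_right) (auto simp: L_def)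
  finally show ?thesis
    by (simp add: L_def)
qed

end
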